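(* Let $\boldsymbol{x}_1,\ldots,\boldsymbol{x}_n$ be a random sample from the truncated multivariate normal distribution $N_d(\boldsymbol{\mu},\boldsymbol{\Sigma};\boldsymbol{0})$, with $\boldsymbol{\mu}\in\mathbb{R}^d$ and $\boldsymbol{\Sigma}$ a positive definite symmetric $d\times d$ matrix. Suppose $n>d$ and that there exists a solution $(\widehat{\boldsymbol{\mu}},\widehat{\boldsymbol{\Sigma}})$, with $\widehat{\boldsymbol{\mu}}\in\mathbb{R}^d$ and $\widehat{\boldsymbol{\Sigma}}$ positive definite, to the score equations $$\widehat{\boldsymbol{\mu}}+[C(\widehat{\boldsymbol{\mu}},\widehat{\boldsymbol{\Sigma}})]^{-1}\,\widehat{\boldsymbol{\Sigma}}\,(\nabla C)(\widehat{\boldsymbol{\mu}},\widehat{\boldsymbol{\Sigma}})=\overline{\boldsymbol{x}},$$ $$\widehat{\boldsymbol{\Sigma}}+[C(\widehat{\boldsymbol{\mu}},\widehat{\boldsymbol{\Sigma}})]^{-1}\,\widehat{\boldsymbol{\Sigma}}\,(\nabla\nabla' C)(\widehat{\boldsymbol{\mu}},\widehat{\boldsymbol{\Sigma}})\,\widehat{\boldsymbol{\Sigma}}-(\overline{\boldsymbol{x}}-\widehat{\boldsymbol{\mu}})(\overline{\boldsymbol{x}}-\widehat{\boldsymbol{\mu}})'=\boldsymbol{S}(\overline{\boldsymbol{x}}).$$ Let $\widehat{\boldsymbol{S}}=\boldsymbol{S}(\widehat{\boldsymbol{\mu}})$. Then $$0\le(\overline{\boldsymbol{x}}-\widehat{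\boldsymbol{\mu}})'\,\widehat{\boldsymbol{S}}^{-1}(\overline{\boldsymbol{x}}-\widehat{\boldsymbol{\mu}})<1.$$
   Context: Notation: $\mathbb{R}_+^d$ is the nonnegative orthant; a prime denotes transpose. $N_d(\boldsymbol{\mu},\boldsymbol{\Sigma};\boldsymbol{0})$ is the distribution with density $$f(\boldsymbol{x};\boldsymbol{\mu},\boldsymbol{\Sigma})=[C(\boldsymbol{\mu},\boldsymbol{\Sigma})]^{-1}\exp\big[-\tfrac12(\boldsymbol{x}-\boldsymbol{\mu})'\boldsymbol{\Sigma}^{-1}(\boldsymbol{x}-\boldsymbol{\mu})\big],\quad\boldsymbol{x}\in\mathbb{R}_+^d,$$ with $$C(\boldsymbol{\mu},\boldsymbol{\Sigma})=\int_{\mathbb{R}_+^d}\exp\big[-\tfrac12(\boldsymbol{w}-\boldsymbol{\mu})'\boldsymbol{\Sigma}^{-1}(\boldsymbol{w}-\boldsymbol{\mu})\big]\,d\boldsymbol{w}.$$ $(\nabla C)(\boldsymbol{\mu},\boldsymbol{\Sigma})$ and $(\nabla\nabla'C)(\boldsymbol{\mu},\boldsymbol{\Sigma})$ denote the gradient (column vector) and Hessian matrix of $\boldsymbol{t}\mapsto C(\boldsymbol{t},\boldsymbol{\Sigma})$ evaluated at $\boldsymbol{t}=\boldsymbol{\mu}$. Also $\overline{\boldsymbol{x}}=n^{-1}\sum_{j=1}^n\boldsymbol{x}_j$ and, for $\boldsymbol{\alpha}\in\mathbb{R}^d$, $\boldsymbol{S}(\boldsymbol{\alpha})=n^{-1}\sum_{j=1}^n(\boldsymbol{x}_j-\boldsymbol{\alpha})(\boldsymbol{x}_j-\boldsymbol{\alpha})'$.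 *)

theory Defs
  imports "HOL-Probability.Probability"
begin

definition pos_def_sym :: "real^'d^'d \<Rightarrow> bool" where
  "pos_def_sym A \<longleftrightarrow> transpose A = A \<and> (\<forall>x. x \<noteq> 0 \<longrightarrow> 0 < x \<bullet> (A *v x))"

definition nonneg_orthant :: "(real^'d) set" where
  "nonneg_orthant = {x. \<forall>i. 0 \<le> x $ i}"

definition gauss_kernel :: "real^'d \<Rightarrow> real^'d^'d \<Rightarrow> real^'d \<Rightarrow> real" where
  "gauss_kernel \<mu> \<Sigma> x = exp (- (1/2) * ((x - \<mu>) \<bullet> (matrix_inv \<Sigma> *v (x - \<mu>))))"

definition tnorm_const :: "real^'d \<Rightarrow> real^'d^'d \<Rightarrow> real" where
  "tnorm_const \<mu> \<Sigma> = (LINT w:nonneg_orthant|lborel. gauss_kernel \<mu> \<Sigma> w)"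

(* Lebesgue density on the whole space, extended by 0 off the orthant *)
definition tnorm_density :: "real^'d \<Rightarrow> real^'d^'d \<Rightarrow> real^'d \<Rightarrow> real" where
  "tnorm_density \<mu> \<Sigma> x =
     indicator nonneg_orthant x * (inverse (tnorm_const \<mu> \<Sigma>) * gauss_kernel \<mu> \<Sigma> x)"

(* deriv is an unspecified value where the partial derivative does not exist; this does not
   occur for t |-> tnorm_const t S with S positive definite, which is smooth *)
definition partial_deriv :: "'d \<Rightarrow> (real^'d \<Rightarrow> real) \<Rightarrow> real^'d \<Rightarrow> real" where
  "partial_deriv i f x = deriv (\<lambda>h. f (x + h *\<^sub>R axis i 1)) 0"

definition gradient :: "(real^'d \<Rightarrow> real) \<Rightarrow> real^'d \<Rightarrow> real^'d" where
  "gradient f x = (\<chi> i. partial_deriv i f x)"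

definition hessian :: "(real^'d \<Rightarrow> real) \<Rightarrow> real^'d \<Rightarrow> real^'d^'d" where
  "hessian f x = (\<chi> i j. partial_deriv i (partial_deriv j f) x)"

definition outer_prod :: "real^'d \<Rightarrow> real^'d \<Rightarrow> real^'d^'d" where
  "outer_prod u v = (\<chi> i j. u $ i * v $ j)"

definition sample_mean :: "nat \<Rightarrow> (nat \<Rightarrow> real^'d) \<Rightarrow> real^'d" where
  "sample_mean n x = (1 / real n) *\<^sub>R (\<Sum>j=1..n. x j)"

definition sample_scatter :: "nat \<Rightarrow> (nat \<Rightarrow> real^'d) \<Rightarrow> real^'d \<Rightarrow> real^'d^'d" where
  "sample_scatter n x \<alpha> = (1 / real n) *\<^sub>R (\<Sum>j=1..n. outer_prod (x j - \<alpha>) (x j - \<alpha>))"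

definition score_equations ::
  "nat \<Rightarrow> (nat \<Rightarrow> real^'d) \<Rightarrow> real^'d \<Rightarrow> real^'d^'d \<Rightarrow> bool" where
  "score_equations n x \<mu> \<Sigma> \<longleftrightarrow>
     \<mu> + inverse (tnorm_const \<mu> \<Sigma>) *\<^sub>R (\<Sigma> *v gradient (\<lambda>t. tnorm_const t \<Sigma>) \<mu>)
       = sample_mean n x \<and>
     \<Sigma> + inverse (tnorm_const \<mu> \<Sigma>) *\<^sub>R (\<Sigma> ** hessian (\<lambda>t. tnorm_const t \<Sigma>) \<mu> ** \<Sigma>)
       - outer_prod (sample_mean n x - \<mu>) (sample_mean n x - \<mu>)
       = sample_scatter n x (sample_mean n x)"

definition tnorm_random_sample ::
  "'a measure \<Rightarrow> nat \<Rightarrow> (nat \<Rightarrow> 'a \<Rightarrow> real^'d) \<Rightarrow> real^'d \<Rightarrow> real^'d^'d \<Rightarrow> bool" where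
  "tnorm_random_sample M n X \<mu> \<Sigma> \<longleftrightarrow>
     prob_space M \<and>
     prob_space.indep_vars M (\<lambda>_. borel) X {1..n} \<and>
     (\<forall>j\<in>{1..n}. distributed M lborel (X j) (\<lambda>x. ennreal (tnorm_density \<mu> \<Sigma> x)))"

end

theory Submission
  imports Defs
begin

text \<open>
  The score equations match moments. Write \<open>W\<close> for a random vector with the fitted law, that is, the
  normal law with parameters \<open>\<mu>hat, \<Sigma>hat\<close> truncated to the orthant, and \<open>v = xbar - \<mu>hat\<close>.
  Differentiating \<open>t \<mapsto> C(t, \<Sigma>hat)\<close> under the integral sign multiplies the integrand by the components of
  \<open>\<Sigma>hat\<inverse> (w - t)\<close>, so the first equation says \<open>E (W - \<mu>hat) = v\<close>, and the second one says that
  \<open>S(xbar) = E (W - \<mu>hat)(W - \<mu>hat)' - v v'\<close>, which is the covariance matrix of \<open>W\<close>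
  (\<open>first_moment_eq_gradient\<close>, \<open>second_moment_eq_hessian\<close>). The law of \<open>W\<close> has a density that is
  positive on the orthant, so no linear functional \<open>u \<bullet> W\<close> with \<open>u \<noteq> 0\<close> is almost surely constant,
  and \<open>S(xbar)\<close> is positive definite (\<open>variance_strictly_positive\<close>,
  \<open>score_equations_scatter_pos_def\<close>).

  Moving the centre of the scatter matrix from \<open>xbar\<close> to \<open>\<mu>hat\<close> gives \<open>Shat = S(xbar) + v v'\<close>. Hence
  \<open>(v \<bullet> u)\<^sup>2 < u \<bullet> (Shat *v u)\<close> for all \<open>u \<noteq> 0\<close>. This makes \<open>Shat\<close> invertible, and for
  \<open>u = Shat\<inverse> v\<close> both sides are expressed by \<open>s = v \<bullet> (Shat\<inverse> v)\<close>: the inequality reads \<open>s\<^sup>2 < s\<close>,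
  so \<open>0 < s < 1\<close>, except that \<open>s = 0\<close> when \<open>v = 0\<close> (\<open>quadratic_form_rank_one_update\<close>).

  The analytic work is the justification of the two differentiations: all integrands that occur are the
  Gaussian kernel times a factor bounded by a multiple of \<open>(1 + \<parallel>w - t\<parallel>)\<^sup>2\<close>, and \<open>gauss_kernel_dominated\<close> bounds these
  by one integrable function as long as \<open>t\<close> stays in a ball.
\<close>

section \<open>Differentiation under the integral sign\<close>

text \<open>
  By the mean value theorem the difference quotients of \<open>F\<close> inherit the bound \<open>g\<close> on \<open>F'\<close>, so dominated
  convergence applies to them along every sequence tending to \<open>a\<close>.
\<close>

lemma has_real_derivative_integral_dominated:
  fixes F F' :: "real \<Rightarrow> 'b \<Rightarrow> real"
  assumes "\<delta> > 0"
    and int: "\<And>h. \<bar>h - a\<bar> < \<delta> \<Longrightarrow> integrable N (F h)"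
    and der: "\<And>h w. \<bar>h - a\<bar> < \<delta> \<Longrightarrow> w \<in> space N \<Longrightarrow>
                ((\<lambda>h. F h w) has_real_derivative F' h w) (at h)"
    and bound: "\<And>h w. \<bar>h - a\<bar> < \<delta> \<Longrightarrow> w \<in> space N \<Longrightarrow> \<bar>F' h w\<bar> \<le> g w"
    and g: "integrable N g"
    and meas: "F' a \<in> borel_measurable N"
  shows "((\<lambda>h. \<integral>w. F h w \<partial>N) has_real_derivative (\<integral>w. F' a w \<partial>N)) (at a)"
proof -
  have quot: "\<bar>(F h w - F a w) / (h - a)\<bar> \<le> g w"
    if h: "\<bar>h - a\<bar> < \<delta>" "h \<noteq> a" and w: "w \<in> space N" for h w
  proof -
    have "norm (F h w - F a w) \<le> g w * norm (h - a)"
    proof (rule field_differentiable_bound[where S = "ball a \<delta>" and f' = "\<lambda>z. F' z w"])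
      fix z assume z: "z \<in> ball a \<delta>"
      then have z': "\<bar>z - a\<bar> < \<delta>" by (simp add: dist_real_def abs_minus_commute)
      show "((\<lambda>h. F h w) has_field_derivative F' z w) (at z within ball a \<delta>)"
        using der[OF z' w] by (rule has_field_derivative_at_within)
      show "norm (F' z w) \<le> g w" using bound[OF z' w] by simp
    qed (use h \<open>\<delta> > 0\<close> in \<open>auto simp: dist_real_def abs_minus_commute\<close>)
    then show ?thesis using h by (simp add: abs_divide divide_simps)
  qed
  have "((\<lambda>h. ((\<integral>w. F h w \<partial>N) - (\<integral>w. F a w \<partial>N)) / (h - a)) \<longlongrightarrow> (\<integral>w. F' a w \<partial>N)) (at a)"
    unfolding tendsto_at_iff_sequentially comp_def
  proof (intro allI impI)
    fix X :: "nat \<Rightarrow> real"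
    assume X: "\<forall>i. X i \<in> UNIV - {a}" "X \<longlonglongrightarrow> a"
    have "\<forall>\<^sub>F i in sequentially. dist (X i) a < \<delta>"
      using X(2) \<open>\<delta> > 0\<close> by (rule tendstoD)
    then obtain k where k: "\<And>i. i \<ge> k \<Longrightarrow> \<bar>X i - a\<bar> < \<delta>"
      by (auto simp: eventually_sequentially dist_real_def)
    \<comment> \<open>Only a tail of the sequence is sure to lie in the neighbourhood where the bound holds.\<close>
    define Y where "Y = (\<lambda>i. X (i + k))"
    have Y: "\<bar>Y i - a\<bar> < \<delta>" "Y i \<noteq> a" for i
      using k[of "i + k"] X(1) by (auto simp: Y_def)
    have Ylim: "Y \<longlonglongrightarrow> a" unfolding Y_def using X(2) by (rule LIMSEQ_ignore_initial_segment)
    have a: "integrable N (F a)" using int[of a] \<open>\<delta> > 0\<close> by simp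
    have "(\<lambda>i. \<integral>w. (F (Y i) w - F a w) / (Y i - a) \<partial>N) \<longlonglongrightarrow> (\<integral>w. F' a w \<partial>N)"
    proof (rule integral_dominated_convergence[where w = g])
      show "(\<lambda>w. (F (Y i) w - F a w) / (Y i - a)) \<in> borel_measurable N" for i
        using int[OF Y(1)] a by (auto intro!: borel_measurable_integrable)
      show "AE w in N. (\<lambda>i. (F (Y i) w - F a w) / (Y i - a)) \<longlonglongrightarrow> F' a w"
      proof (rule AE_I2)
        fix w assume w: "w \<in> space N"
        have "((\<lambda>h. (F h w - F a w) / (h - a)) \<longlongrightarrow> F' a w) (at a)"
          using der[of a, OF _ w] \<open>\<delta> > 0\<close> by (simp add: has_field_derivative_iff)
        then show "(\<lambda>i. (F (Y i) w - F a w) / (Y i - a)) \<longlonglongrightarrow> F' a w"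
          unfolding tendsto_at_iff_sequentially comp_def using Y(2) Ylim by auto
      qed
      show "AE w in N. norm ((F (Y i) w - F a w) / (Y i - a)) \<le> g w" for i
        using quot[OF Y] by (auto intro!: AE_I2)
    qed (use g meas in auto)
    then have "(\<lambda>i. ((\<integral>w. F (Y i) w \<partial>N) - (\<integral>w. F a w \<partial>N)) / (Y i - a)) \<longlonglongrightarrow> (\<integral>w. F' a w \<partial>N)"
      using int[OF Y(1)] a by (simp add: Bochner_Integration.integral_diff)
    then show "(\<lambda>i. ((\<integral>w. F (X i) w \<partial>N) - (\<integral>w. F a w \<partial>N)) / (X i - a)) \<longlonglongrightarrow> (\<integral>w. F' a w \<partial>N)"
      unfolding Y_def by (rule LIMSEQ_offset)
  qed
  then show ?thesis by (simp add: has_field_derivative_iff)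
qed

section \<open>Positive definite matrices\<close>

lemma pos_def_imp_invertible:
  fixes A :: "real^'d^'d"
  assumes "\<And>u. u \<noteq> 0 \<Longrightarrow> 0 < u \<bullet> (A *v u)"
  shows "invertible A"
proof -
  have "\<forall>x. A *v x = 0 \<longrightarrow> x = 0"
    using assms by (metis inner_zero_right less_irrefl)
  then show ?thesis
    by (simp add: invertible_left_inverse matrix_left_invertible_ker)
qed

lemma matrix_inv_mult_vec:
  fixes A :: "real^'d^'d"
  assumes "invertible A"
  shows "A *v (matrix_inv A *v x) = x" "matrix_inv A *v (A *v x) = x"
proof -
  have "\<exists>B. A ** B = mat 1 \<and> B ** A = mat 1" using assms by (simp add: invertible_def)
  then have "A ** matrix_inv A = mat 1 \<and> matrix_inv A ** A = mat 1"
    unfolding matrix_inv_def by (rule someI_ex)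
  then show "A *v (matrix_inv A *v x) = x" "matrix_inv A *v (A *v x) = x"
    by (simp_all add: matrix_vector_mul_assoc)
qed

lemma symmetric_inner_commute:
  fixes A :: "real^'d^'d"
  assumes "transpose A = A"
  shows "x \<bullet> (A *v y) = (A *v x) \<bullet> y"
  using assms dot_lmul_matrix[of x A y] by (metis vector_transpose_matrix)

lemma pos_def_sym_invertible: "pos_def_sym A \<Longrightarrow> invertible A"
  by (rule pos_def_imp_invertible) (simp add: pos_def_sym_def)

text \<open>
  Symmetry of the inverse matrix, in the form needed for expanding the quadratic form in the exponent.
\<close>

lemma pos_def_sym_inv_commute:
  assumes "pos_def_sym A"
  shows "x \<bullet> (matrix_inv A *v y) = y \<bullet> (matrix_inv A *v x)"
proof -
  have inv: "A *v (matrix_inv A *v z) = z" for z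
    using pos_def_sym_invertible[OF assms] by (rule matrix_inv_mult_vec)
  have sym: "transpose A = A" using assms by (simp add: pos_def_sym_def)
  have "x \<bullet> (matrix_inv A *v y) = (A *v (matrix_inv A *v x)) \<bullet> (matrix_inv A *v y)"
    by (simp add: inv)
  also have "\<dots> = (matrix_inv A *v x) \<bullet> (A *v (matrix_inv A *v y))"
    by (rule symmetric_inner_commute[OF sym, symmetric])
  finally show ?thesis by (simp add: inv inner_commute)
qed

text \<open>
  The constant is the minimum of the quadratic form over the compact unit sphere; homogeneity extends
  the bound to all vectors.
\<close>

lemma pos_def_sym_inv_coercive:
  fixes A :: "real^'d^'d"
  assumes "pos_def_sym A"
  obtains c where "c > 0" "\<And>z. c * (norm z)\<^sup>2 \<le> z \<bullet> (matrix_inv A *v z)"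
proof -
  let ?q = "\<lambda>z. z \<bullet> (matrix_inv A *v z)"
  have inv: "A *v (matrix_inv A *v z) = z" for z
    using pos_def_sym_invertible[OF assms] by (rule matrix_inv_mult_vec)
  have pos: "0 < ?q z" if "z \<noteq> 0" for z
  proof -
    have "matrix_inv A *v z \<noteq> 0" using inv[of z] that by auto
    then have "0 < (matrix_inv A *v z) \<bullet> (A *v (matrix_inv A *v z))"
      using assms unfolding pos_def_sym_def by blast
    then show ?thesis by (simp add: inv inner_commute)
  qed
  have "continuous_on (sphere 0 1) ?q"
    by (intro continuous_intros matrix_vector_mult_linear_continuous_on)
  moreover have "sphere (0::real^'d) 1 \<noteq> {}" by simp
  ultimately obtain z0 where z0: "z0 \<in> sphere 0 1" "\<And>y. y \<in> sphere 0 1 \<Longrightarrow> ?q z0 \<le> ?q y"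
    using continuous_attains_inf[OF compact_sphere, of 0 1 ?q] by blast
  show thesis
  proof (rule that)
    show "?q z0 > 0" using z0(1) by (intro pos) auto
    fix z :: "real^'d"
    show "?q z0 * (norm z)\<^sup>2 \<le> ?q z"
    proof (cases "z = 0")
      case False
      let ?y = "z /\<^sub>R norm z"
      have "?q z0 \<le> ?q ?y" using z0(2)[of ?y] False by simp
      also have "?q ?y = ?q z / (norm z)\<^sup>2"
        by (simp add: matrix_vector_mult_scaleR power2_eq_square divide_simps)
      finally show ?thesis using False by (simp add: divide_simps)
    qed simp
  qed
qed

text \<open>
  The hypothesis says that \<open>S - v v'\<close> is positive definite. Testing it at \<open>z = S\<inverse> v\<close>, where
  \<open>z \<bullet> (S *v z) = v \<bullet> z\<close>, gives \<open>(v \<bullet> z)\<^sup>2 < v \<bullet> z\<close>.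
\<close>

lemma quadratic_form_rank_one_update:
  fixes S :: "real^'d^'d"
  assumes pos: "\<And>u. u \<noteq> 0 \<Longrightarrow> (v \<bullet> u)\<^sup>2 < u \<bullet> (S *v u)"
  shows "invertible S" "0 \<le> v \<bullet> (matrix_inv S *v v)" "v \<bullet> (matrix_inv S *v v) < 1"
proof -
  show inv: "invertible S"
    by (rule pos_def_imp_invertible) (meson pos le_less_trans zero_le_power2)
  define z where "z = matrix_inv S *v v"
  have Sz: "S *v z = v" unfolding z_def by (rule matrix_inv_mult_vec[OF inv])
  have "0 \<le> v \<bullet> z \<and> v \<bullet> z < 1"
  proof (cases "z = 0")
    case False
    have lt: "(v \<bullet> z)\<^sup>2 < v \<bullet> z" using pos[OF False] by (simp add: Sz inner_commute)
    then have "0 < v \<bullet> z" by (meson le_less_trans zero_le_power2)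
    then show ?thesis using lt by (simp add: power2_eq_square)
  qed simp
  then show "0 \<le> v \<bullet> (matrix_inv S *v v)" "v \<bullet> (matrix_inv S *v v) < 1"
    by (simp_all add: z_def)
qed

section \<open>Gaussian domination\<close>

text \<open>
  The function is a product over the coordinates, so its integral is a power of a one-dimensional Gaussian
  integral.
\<close>

lemma integrable_exp_norm_square:
  fixes a :: real
  assumes "a > 0"
  shows "integrable lborel (\<lambda>w::'e::euclidean_space. exp (- a * (norm w)\<^sup>2))"
proof (rule integrableI_nonneg)
  \<comment> \<open>The normal density with this standard deviation is a multiple of \<open>exp (- a * x\<^sup>2)\<close>.\<close>
  define \<sigma> where "\<sigma> = sqrt (1 / (2 * a))"
  have \<sigma>: "\<sigma> > 0" "2 * \<sigma>\<^sup>2 = 1 / a" using assms by (auto simp: \<sigma>_def)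
  have "integrable lborel (\<lambda>x. sqrt (2 * pi * \<sigma>\<^sup>2) * normal_density 0 \<sigma> x)"
    using \<sigma>(1) by (intro integrable_mult_right integrable_normal_density)
  also have "(\<lambda>x. sqrt (2 * pi * \<sigma>\<^sup>2) * normal_density 0 \<sigma> x) = (\<lambda>x. exp (- a * x\<^sup>2))"
    using \<sigma> by (auto simp: normal_density_def fun_eq_iff)
  finally have fin: "(\<integral>\<^sup>+x. ennreal (exp (- a * x\<^sup>2)) \<partial>lborel) < \<infinity>"
    by (simp add: integrable_iff_bounded)
  have "(\<integral>\<^sup>+w. ennreal (exp (- a * (norm (w::'e))\<^sup>2)) \<partial>lborel)
      = (\<integral>\<^sup>+w. (\<Prod>b\<in>Basis. ennreal (exp (- a * ((w::'e) \<bullet> b)\<^sup>2))) \<partial>lborel)"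
    unfolding power2_norm_eq_inner
    by (subst euclidean_inner)
       (simp add: prod_ennreal exp_sum[symmetric] sum_distrib_left sum_negf power2_eq_square)
  also have "\<dots> = (\<Prod>b\<in>(Basis::'e set). \<integral>\<^sup>+x. ennreal (exp (- a * x\<^sup>2)) \<partial>lborel)"
    by (rule nn_integral_lborel_prod) auto
  also have "\<dots> < \<infinity>"
    using fin by (simp add: power_less_top_ennreal)
  finally show "(\<integral>\<^sup>+w. ennreal (exp (- a * (norm (w::'e))\<^sup>2)) \<partial>lborel) < \<infinity>" .
qed auto

text \<open>
  With \<open>l\<close> a coercivity constant of \<open>\<Sigma>\<inverse>\<close> and \<open>r = \<parallel>w - t\<parallel>\<close>, the kernel is at most \<open>exp (- l r\<^sup>2 / 2)\<close>.
  Half of this decay absorbs the quadratic factor; the other half dominates a Gaussian centred at \<open>0\<close>,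
  uniformly in \<open>t\<close>, because \<open>\<parallel>w\<parallel>\<^sup>2 \<le> 2 r\<^sup>2 + 2 R\<^sup>2\<close>.
\<close>

lemma gauss_kernel_dominated:
  fixes \<Sigma> :: "real^'d^'d"
  assumes "pos_def_sym \<Sigma>"
  shows "\<exists>a c. a > 0 \<and> (\<forall>t w. norm t \<le> R \<longrightarrow>
       (1 + norm (w - t))\<^sup>2 * gauss_kernel t \<Sigma> w \<le> c * exp (- a * (norm w)\<^sup>2))"
proof -
  obtain l where l: "l > 0" "\<And>z. l * (norm z)\<^sup>2 \<le> z \<bullet> (matrix_inv \<Sigma> *v z)"
    using pos_def_sym_inv_coercive[OF assms] by blast
  show ?thesis
  proof (intro exI conjI allI impI)
    show "l / 8 > 0" using l by simp
    fix t w :: "real^'d" assume t: "norm t \<le> R"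
    define r where "r = norm (w - t)"
    have "(1 + r)\<^sup>2 \<le> 2 + 2 * r\<^sup>2"
      using zero_le_power2[of "1 - r"] by (simp add: power2_eq_square algebra_simps)
    also have "\<dots> \<le> (2 + 8 / l) * (1 + l / 4 * r\<^sup>2)"
      using l(1) by (simp add: field_simps)
    also have "\<dots> \<le> (2 + 8 / l) * exp (l / 4 * r\<^sup>2)"
      using l(1) exp_ge_add_one_self[of "l / 4 * r\<^sup>2"] by (intro mult_left_mono) auto
    finally have poly: "(1 + r)\<^sup>2 \<le> (2 + 8 / l) * exp (l / 4 * r\<^sup>2)" .
    have "norm w \<le> r + norm t"
      unfolding r_def using norm_triangle_ineq[of "w - t" t] by simp
    also have "\<dots> \<le> r + R" using t by simp
    finally have "(norm w)\<^sup>2 \<le> (r + R)\<^sup>2" by (simp add: power_mono)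
    also have "\<dots> \<le> 2 * r\<^sup>2 + 2 * R\<^sup>2"
      using zero_le_power2[of "r - R"] by (simp add: power2_eq_square algebra_simps)
    finally have "l / 8 * (norm w)\<^sup>2 \<le> l / 8 * (2 * r\<^sup>2 + 2 * R\<^sup>2)"
      using l(1) by (intro mult_left_mono) auto
    then have expo: "- (l / 4) * r\<^sup>2 \<le> l / 4 * R\<^sup>2 + - (l / 8) * (norm w)\<^sup>2"
      by (simp add: algebra_simps)
    have "gauss_kernel t \<Sigma> w \<le> exp (- (l / 2) * r\<^sup>2)"
      using l(2)[of "w - t"] by (simp add: gauss_kernel_def r_def)
    then have "(1 + r)\<^sup>2 * gauss_kernel t \<Sigma> w
        \<le> ((2 + 8 / l) * exp (l / 4 * r\<^sup>2)) * exp (- (l / 2) * r\<^sup>2)"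
      using poly l(1) by (intro mult_mono) (auto simp: gauss_kernel_def)
    also have "\<dots> = (2 + 8 / l) * exp (- (l / 4) * r\<^sup>2)"
      by (simp add: mult.assoc exp_add[symmetric])
    also have "\<dots> \<le> (2 + 8 / l) * exp (l / 4 * R\<^sup>2 + - (l / 8) * (norm w)\<^sup>2)"
      using expo l(1) by (intro mult_left_mono) auto
    also have "\<dots> = (2 + 8 / l) * exp (l / 4 * R\<^sup>2) * exp (- (l / 8) * (norm w)\<^sup>2)"
      by (simp only: exp_add mult.assoc)
    finally show "(1 + norm (w - t))\<^sup>2 * gauss_kernel t \<Sigma> w
        \<le> (2 + 8 / l) * exp (l / 4 * R\<^sup>2) * exp (- (l / 8) * (norm w)\<^sup>2)"
      by (simp add: r_def)
  qed
qed

section \<open>Integrals over the orthant\<close>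

abbreviation orthant_measure :: "(real^'d) measure" where
  "orthant_measure \<equiv> restrict_space lborel nonneg_orthant"

lemma closed_nonneg_orthant: "closed (nonneg_orthant :: (real^'d) set)"
  unfolding nonneg_orthant_def
  by (intro closed_Collect_all closed_Collect_le continuous_intros)

lemma integrable_orthant:
  fixes f :: "real^'d \<Rightarrow> real"
  assumes "integrable lborel f"
  shows "integrable orthant_measure f"
  using assms borel_closed[OF closed_nonneg_orthant]
  by (subst integrable_restrict_space) (auto intro!: integrable_real_mult_indicator simp: mult.commute)

lemma borel_measurable_orthant:
  "f \<in> borel_measurable borel \<Longrightarrow> f \<in> borel_measurable orthant_measure"
  by (rule measurable_restrict_space1) simp

lemma tnorm_const_eq_integral:
  "tnorm_const t \<Sigma> = (\<integral>w. gauss_kernel t \<Sigma> w \<partial>orthant_measure)"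
  unfolding tnorm_const_def set_lebesgue_integral_def
  by (rule integral_restrict_space[symmetric])
     (simp add: borel_closed closed_nonneg_orthant)

lemma gauss_kernel_borel_measurable:
  "gauss_kernel t \<Sigma> \<in> borel_measurable borel"
  unfolding gauss_kernel_def
  by (intro borel_measurable_continuous_onI continuous_intros
        bounded_linear.continuous_on[OF matrix_vector_mul_bounded_linear])

lemma integrable_gauss_moment:
  fixes \<Sigma> :: "real^'d^'d"
  assumes \<Sigma>: "pos_def_sym \<Sigma>"
    and f: "f \<in> borel_measurable borel"
    and bound: "\<And>w. \<bar>f w\<bar> \<le> L * (1 + norm (w - t))\<^sup>2"
  shows "integrable orthant_measure (\<lambda>w. f w * gauss_kernel t \<Sigma> w)"
proof -
  obtain a c where a: "a > 0" and
    dom: "\<And>s w. norm s \<le> norm t \<Longrightarrow>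
       (1 + norm (w - s))\<^sup>2 * gauss_kernel s \<Sigma> w \<le> c * exp (- a * (norm w)\<^sup>2)"
    using gauss_kernel_dominated[OF \<Sigma>, of "norm t"] by meson
  have L: "L \<ge> 0" using bound[of t] by simp
  have "integrable orthant_measure (\<lambda>w. L * (c * exp (- a * (norm w)\<^sup>2)))"
    by (intro integrable_orthant integrable_mult_right integrable_exp_norm_square a)
  then show ?thesis
  proof (rule Bochner_Integration.integrable_bound)
    show "(\<lambda>w. f w * gauss_kernel t \<Sigma> w) \<in> borel_measurable orthant_measure"
      by (intro borel_measurable_orthant borel_measurable_times f gauss_kernel_borel_measurable)
    have "\<bar>f w * gauss_kernel t \<Sigma> w\<bar> \<le> \<bar>L * (c * exp (- a * (norm w)\<^sup>2))\<bar>" for w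
    proof -
      have "\<bar>f w * gauss_kernel t \<Sigma> w\<bar> \<le> L * (1 + norm (w - t))\<^sup>2 * gauss_kernel t \<Sigma> w"
        using bound[of w] by (simp add: abs_mult gauss_kernel_def)
      also have "\<dots> \<le> L * (c * exp (- a * (norm w)\<^sup>2))"
        using mult_left_mono[OF dom[of t w] L] by (simp add: mult.assoc)
      finally show ?thesis by simp
    qed
    then show "AE w in orthant_measure. norm (f w * gauss_kernel t \<Sigma> w)
        \<le> norm (L * (c * exp (- a * (norm w)\<^sup>2)))"
      by simp
  qed
qed

text \<open>
  This form covers both differentiations: the first partial derivatives of the normalising constant come from
  the constant factor \<open>f = 1\<close>, and the second ones from a factor \<open>f\<close> that is linear in \<open>w - s\<close>.
\<close>

lemma has_derivative_gauss_integral: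
  fixes \<Sigma> :: "real^'d^'d"
  assumes \<Sigma>: "pos_def_sym \<Sigma>"
    and meas: "\<And>s. f s \<in> borel_measurable borel" "\<And>s. f' s \<in> borel_measurable borel"
    and bound: "\<And>s w. \<bar>f s w\<bar> \<le> L * (1 + norm (w - s))\<^sup>2"
               "\<And>s w. \<bar>f' s w\<bar> \<le> L * (1 + norm (w - s))\<^sup>2"
    and der: "\<And>h w. ((\<lambda>h. f (t + h *\<^sub>R e) w * gauss_kernel (t + h *\<^sub>R e) \<Sigma> w)
        has_real_derivative f' (t + h *\<^sub>R e) w * gauss_kernel (t + h *\<^sub>R e) \<Sigma> w) (at h)"
  shows "((\<lambda>h. \<integral>w. f (t + h *\<^sub>R e) w * gauss_kernel (t + h *\<^sub>R e) \<Sigma> w \<partial>orthant_measure)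
      has_real_derivative (\<integral>w. f' t w * gauss_kernel t \<Sigma> w \<partial>orthant_measure)) (at 0)"
proof -
  obtain a c where a: "a > 0" and
    dom: "\<And>s w. norm s \<le> norm t + norm e \<Longrightarrow>
       (1 + norm (w - s))\<^sup>2 * gauss_kernel s \<Sigma> w \<le> c * exp (- a * (norm w)\<^sup>2)"
    using gauss_kernel_dominated[OF \<Sigma>, of "norm t + norm e"] by meson
  have L: "L \<ge> 0" using bound(1)[of t t] by simp
  have "((\<lambda>h. \<integral>w. f (t + h *\<^sub>R e) w * gauss_kernel (t + h *\<^sub>R e) \<Sigma> w \<partial>orthant_measure)
      has_real_derivative
      (\<integral>w. f' (t + 0 *\<^sub>R e) w * gauss_kernel (t + 0 *\<^sub>R e) \<Sigma> w \<partial>orthant_measure)) (at 0)"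
  proof (rule has_real_derivative_integral_dominated
      [where \<delta> = 1 and g = "\<lambda>w. L * (c * exp (- a * (norm w)\<^sup>2))"
        and F' = "\<lambda>h w. f' (t + h *\<^sub>R e) w * gauss_kernel (t + h *\<^sub>R e) \<Sigma> w"])
    show "integrable orthant_measure
        (\<lambda>w. f (t + h *\<^sub>R e) w * gauss_kernel (t + h *\<^sub>R e) \<Sigma> w)" for h
      by (rule integrable_gauss_moment[OF \<Sigma> meas(1) bound(1)])
    show "integrable orthant_measure (\<lambda>w. L * (c * exp (- a * (norm w)\<^sup>2)))"
      by (intro integrable_orthant integrable_mult_right integrable_exp_norm_square a)
    show "(\<lambda>w. f' (t + 0 *\<^sub>R e) w * gauss_kernel (t + 0 *\<^sub>R e) \<Sigma> w)
        \<in> borel_measurable orthant_measure"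
      by (intro borel_measurable_orthant borel_measurable_times meas(2)
          gauss_kernel_borel_measurable)
    fix h :: real and w :: "real^'d" assume h: "\<bar>h - 0\<bar> < 1"
    \<comment> \<open>For \<open>\<bar>h\<bar> < 1\<close> the shifted parameter stays in the ball on which the domination is uniform.\<close>
    let ?s = "t + h *\<^sub>R e"
    have "norm ?s \<le> norm t + \<bar>h\<bar> * norm e" by (metis norm_scaleR norm_triangle_ineq)
    also have "\<dots> \<le> norm t + norm e" using h by (simp add: mult_left_le_one_le)
    finally have s: "norm ?s \<le> norm t + norm e" .
    have "\<bar>f' ?s w * gauss_kernel ?s \<Sigma> w\<bar> \<le> L * (1 + norm (w - ?s))\<^sup>2 * gauss_kernel ?s \<Sigma> w"
      using bound(2)[of ?s w] by (simp add: abs_mult gauss_kernel_def)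
    also have "\<dots> \<le> L * (c * exp (- a * (norm w)\<^sup>2))"
      using mult_left_mono[OF dom[OF s] L] by (simp add: mult.assoc)
    finally show "\<bar>f' ?s w * gauss_kernel ?s \<Sigma> w\<bar> \<le> L * (c * exp (- a * (norm w)\<^sup>2))" .
  qed (use der in auto)
  then show ?thesis by simp
qed

section \<open>Gradient and Hessian of the normalising constant\<close>

lemma gauss_kernel_has_derivative:
  assumes "pos_def_sym \<Sigma>"
  shows "((\<lambda>h. gauss_kernel (t + h *\<^sub>R e) \<Sigma> w) has_real_derivative
      (e \<bullet> (matrix_inv \<Sigma> *v (w - (t + h *\<^sub>R e)))) * gauss_kernel (t + h *\<^sub>R e) \<Sigma> w) (at h)"
proof -
  define z where "z = w - t"
  define P where "P = matrix_inv \<Sigma>"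
  have com: "z \<bullet> (P *v e) = e \<bullet> (P *v z)"
    unfolding P_def by (rule pos_def_sym_inv_commute[OF assms])
  have shift: "w - (t + h *\<^sub>R e) = z - h *\<^sub>R e" for h by (simp add: z_def)
  have quad: "(z - h *\<^sub>R e) \<bullet> (P *v (z - h *\<^sub>R e))
      = z \<bullet> (P *v z) - 2 * h * (e \<bullet> (P *v z)) + h\<^sup>2 * (e \<bullet> (P *v e))" for h
    by (simp add: matrix_vector_mult_diff_distrib matrix_vector_mult_scaleR
        inner_diff_left inner_diff_right com power2_eq_square algebra_simps)
  have lin: "e \<bullet> (P *v (z - h *\<^sub>R e)) = e \<bullet> (P *v z) - h * (e \<bullet> (P *v e))"
    by (simp add: matrix_vector_mult_diff_distrib matrix_vector_mult_scaleR inner_diff_right)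
  show ?thesis
    unfolding gauss_kernel_def shift P_def[symmetric] quad lin
    by (auto intro!: derivative_eq_intros simp: algebra_simps)
qed

lemma score_has_derivative:
  fixes \<Sigma> :: "real^'d^'d"
  shows "((\<lambda>h. f \<bullet> (matrix_inv \<Sigma> *v (w - (t + h *\<^sub>R e)))) has_real_derivative
      - (f \<bullet> (matrix_inv \<Sigma> *v e))) (at h)"
proof -
  have "f \<bullet> (matrix_inv \<Sigma> *v (w - (t + h *\<^sub>R e)))
      = f \<bullet> (matrix_inv \<Sigma> *v (w - t)) - h * (f \<bullet> (matrix_inv \<Sigma> *v e))" for h
    by (simp add: matrix_vector_mult_diff_distrib matrix_vector_right_distrib
        matrix_vector_mult_scaleR inner_diff_right inner_add_right)
  then show ?thesis by (auto intro!: derivative_eq_intros)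
qed

lemma bilinear_form_bound:
  fixes P :: "real^'d^'d"
  obtains L where "L \<ge> 0" "\<And>z. \<bar>f \<bullet> (P *v z)\<bar> \<le> L * norm z"
proof -
  obtain M where M: "M > 0" "\<And>z. norm (P *v z) \<le> norm z * M"
    using bounded_linear.pos_bounded[OF matrix_vector_mul_bounded_linear[of P]] by blast
  show thesis
  proof (rule that)
    show "norm f * M \<ge> 0" using M by simp
    show "\<bar>f \<bullet> (P *v z)\<bar> \<le> norm f * M * norm z" for z
      using Cauchy_Schwarz_ineq2[of f "P *v z"] mult_left_mono[OF M(2)[of z] norm_ge_zero[of f]]
      by (simp add: algebra_simps)
  qed
qed

lemma le_quadratic_weight:
  fixes r :: real
  assumes "r \<ge> 0"
  shows "1 \<le> (1 + r)\<^sup>2" "r \<le> (1 + r)\<^sup>2" "r\<^sup>2 \<le> (1 + r)\<^sup>2"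
  using assms by (auto simp: power2_eq_square algebra_simps)

lemma borel_measurable_score:
  fixes P :: "real^'d^'d"
  shows "(\<lambda>w. f \<bullet> (P *v (w - t))) \<in> borel_measurable borel"
  by (intro borel_measurable_continuous_onI continuous_intros
        bounded_linear.continuous_on[OF matrix_vector_mul_bounded_linear])

lemma partial_deriv_tnorm_const:
  fixes \<Sigma> :: "real^'d^'d"
  assumes \<Sigma>: "pos_def_sym \<Sigma>"
  shows "partial_deriv j (\<lambda>t. tnorm_const t \<Sigma>) t =
    (\<integral>w. (axis j 1 \<bullet> (matrix_inv \<Sigma> *v (w - t))) * gauss_kernel t \<Sigma> w \<partial>orthant_measure)"
proof -
  let ?e = "axis j 1 :: real^'d"
  obtain L where L: "L \<ge> 0" "\<And>z. \<bar>?e \<bullet> (matrix_inv \<Sigma> *v z)\<bar> \<le> L * norm z"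
    using bilinear_form_bound by blast
  have "((\<lambda>h. \<integral>w. 1 * gauss_kernel (t + h *\<^sub>R ?e) \<Sigma> w \<partial>orthant_measure)
      has_real_derivative
      (\<integral>w. (?e \<bullet> (matrix_inv \<Sigma> *v (w - t))) * gauss_kernel t \<Sigma> w \<partial>orthant_measure)) (at 0)"
  proof (rule has_derivative_gauss_integral[OF \<Sigma>, where L = "1 + L"])
    show "\<bar>1\<bar> \<le> (1 + L) * (1 + norm (w - s))\<^sup>2" for s w :: "real^'d"
      using mult_mono[of 1 "1 + L" 1 "(1 + norm (w - s))\<^sup>2"] le_quadratic_weight(1)[of "norm (w - s)"] L(1)
      by simp
    show "\<bar>?e \<bullet> (matrix_inv \<Sigma> *v (w - s))\<bar> \<le> (1 + L) * (1 + norm (w - s))\<^sup>2" for s w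
      using L(2)[of "w - s"] mult_mono[of L "1 + L" "norm (w - s)" "(1 + norm (w - s))\<^sup>2"]
        le_quadratic_weight(2)[of "norm (w - s)"] L(1)
      by simp
  qed (use gauss_kernel_has_derivative[OF \<Sigma>] in \<open>auto intro: borel_measurable_score\<close>)
  then show ?thesis
    unfolding partial_deriv_def tnorm_const_eq_integral by (simp add: DERIV_imp_deriv)
qed

text \<open>
  The derivative of \<open>f \<bullet> (P *v (w - t))\<close> times the kernel has two parts: the kernel contributes a second
  linear factor, and the linear factor contributes the constant \<open>- P $ i $ j\<close>.
\<close>

lemma hessian_tnorm_const:
  fixes \<Sigma> :: "real^'d^'d"
  assumes \<Sigma>: "pos_def_sym \<Sigma>"
  defines "P \<equiv> matrix_inv \<Sigma>"
  shows "hessian (\<lambda>t. tnorm_const t \<Sigma>) t $ i $ j =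
    (\<integral>w. ((P *v (w - t)) $ i * (P *v (w - t)) $ j - P $ i $ j) * gauss_kernel t \<Sigma> w
      \<partial>orthant_measure)"
proof -
  let ?e = "axis i 1 :: real^'d" and ?f = "axis j 1 :: real^'d"
  let ?c = "?f \<bullet> (P *v ?e)"
  obtain L where L: "L \<ge> 0" "\<And>z. \<bar>?e \<bullet> (P *v z)\<bar> \<le> L * norm z"
    using bilinear_form_bound by blast
  obtain K where K: "K \<ge> 0" "\<And>z. \<bar>?f \<bullet> (P *v z)\<bar> \<le> K * norm z"
    using bilinear_form_bound by blast
  have "((\<lambda>h. \<integral>w. (?f \<bullet> (P *v (w - (t + h *\<^sub>R ?e)))) * gauss_kernel (t + h *\<^sub>R ?e) \<Sigma> w
        \<partial>orthant_measure)
      has_real_derivative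
      (\<integral>w. ((?e \<bullet> (P *v (w - t))) * (?f \<bullet> (P *v (w - t))) - ?c) * gauss_kernel t \<Sigma> w
        \<partial>orthant_measure)) (at 0)"
  proof (rule has_derivative_gauss_integral[OF \<Sigma>, where L = "K + L * K + \<bar>?c\<bar>"])
    fix s w :: "real^'d"
    let ?r = "norm (w - s)"
    let ?W = "(1 + ?r)\<^sup>2"
    note W = le_quadratic_weight[OF norm_ge_zero[of "w - s"]]
    have 1: "K * ?r \<le> K * ?W" "L * K * ?r\<^sup>2 \<le> L * K * ?W" "\<bar>?c\<bar> \<le> \<bar>?c\<bar> * ?W"
      using mult_left_mono[OF W(2) K(1)] mult_left_mono[OF W(3), of "L * K"]
        mult_left_mono[OF W(1), of "\<bar>?c\<bar>"] K(1) L(1) by auto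
    have 2: "0 \<le> K * ?W" "0 \<le> L * K * ?W" "0 \<le> \<bar>?c\<bar> * ?W"
      using K(1) L(1) by auto
    show "\<bar>?f \<bullet> (P *v (w - s))\<bar> \<le> (K + L * K + \<bar>?c\<bar>) * ?W"
      using K(2)[of "w - s"] 1 2 by (simp add: distrib_right)
    have "\<bar>(?e \<bullet> (P *v (w - s))) * (?f \<bullet> (P *v (w - s)))\<bar> \<le> (L * ?r) * (K * ?r)"
      unfolding abs_mult using K(1) L(1) by (intro mult_mono K(2) L(2)) auto
    also have "\<dots> = L * K * ?r\<^sup>2" by (simp add: power2_eq_square)
    finally show "\<bar>(?e \<bullet> (P *v (w - s))) * (?f \<bullet> (P *v (w - s))) - ?c\<bar>
        \<le> (K + L * K + \<bar>?c\<bar>) * ?W"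
      using 1 2 by (simp add: distrib_right)
  next
    fix h :: real and w :: "real^'d"
    show "((\<lambda>h. (?f \<bullet> (P *v (w - (t + h *\<^sub>R ?e)))) * gauss_kernel (t + h *\<^sub>R ?e) \<Sigma> w)
        has_real_derivative
        ((?e \<bullet> (P *v (w - (t + h *\<^sub>R ?e)))) * (?f \<bullet> (P *v (w - (t + h *\<^sub>R ?e)))) - ?c)
          * gauss_kernel (t + h *\<^sub>R ?e) \<Sigma> w) (at h)"
      using DERIV_mult[OF score_has_derivative[of ?f \<Sigma> w t ?e h]
          gauss_kernel_has_derivative[OF \<Sigma>, of t ?e w h]]
      unfolding P_def by (rule DERIV_cong) (simp add: algebra_simps)
  qed (intro borel_measurable_score borel_measurable_times borel_measurable_diff
      borel_measurable_const)+
  moreover have "?c = P $ i $ j"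
    using pos_def_sym_inv_commute[OF \<Sigma>, of ?f ?e]
    by (simp add: P_def inner_axis' matrix_vector_mul_component inner_axis)
  ultimately show ?thesis
    unfolding hessian_def partial_deriv_tnorm_const[OF \<Sigma>, abs_def]
    by (simp add: partial_deriv_def[of i] P_def[symmetric] DERIV_imp_deriv inner_axis')
qed

section \<open>Moments of the fitted distribution\<close>

lemma integrable_directional_moments:
  fixes \<Sigma> :: "real^'d^'d" and u t :: "real^'d"
  assumes \<Sigma>: "pos_def_sym \<Sigma>"
  shows "integrable orthant_measure (gauss_kernel t \<Sigma>)"
    and "integrable orthant_measure (\<lambda>w. (u \<bullet> (w - t)) * gauss_kernel t \<Sigma> w)"
    and "integrable orthant_measure (\<lambda>w. (u \<bullet> (w - t))\<^sup>2 * gauss_kernel t \<Sigma> w)"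
proof -
  have b: "\<bar>u \<bullet> (w - t)\<bar> \<le> norm u * norm (w - t)" for w by (rule Cauchy_Schwarz_ineq2)
  note W = le_quadratic_weight[OF norm_ge_zero]
  show "integrable orthant_measure (gauss_kernel t \<Sigma>)"
    using integrable_gauss_moment[OF \<Sigma>, of "\<lambda>_. 1" 1 t] W(1) by simp
  show "integrable orthant_measure (\<lambda>w. (u \<bullet> (w - t)) * gauss_kernel t \<Sigma> w)"
  proof (rule integrable_gauss_moment[OF \<Sigma>])
    show "\<bar>u \<bullet> (w - t)\<bar> \<le> norm u * (1 + norm (w - t))\<^sup>2" for w
      using b[of w] mult_left_mono[OF W(2) norm_ge_zero] by (rule order_trans)
  qed simp
  show "integrable orthant_measure (\<lambda>w. (u \<bullet> (w - t))\<^sup>2 * gauss_kernel t \<Sigma> w)"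
  proof (rule integrable_gauss_moment[OF \<Sigma>])
    fix w
    have "(u \<bullet> (w - t))\<^sup>2 \<le> (norm u * norm (w - t))\<^sup>2"
      using power_mono[OF b[of w] abs_ge_zero, of 2] by simp
    also have "\<dots> \<le> (norm u)\<^sup>2 * (1 + norm (w - t))\<^sup>2"
      unfolding power_mult_distrib by (intro mult_left_mono W(3)) auto
    finally show "\<bar>(u \<bullet> (w - t))\<^sup>2\<bar> \<le> (norm u)\<^sup>2 * (1 + norm (w - t))\<^sup>2" by simp
  qed simp
qed

text \<open>
  Moving \<open>\<Sigma>\<close> to the other side of the inner product cancels the factor \<open>\<Sigma>\<inverse>\<close> in the gradient: this is
  \<open>\<Sigma> \<nabla>C = C E (W - t)\<close>, for \<open>W\<close> truncated normal with parameters \<open>t, \<Sigma>\<close>, tested against \<open>u\<close>.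
\<close>

lemma first_moment_eq_gradient:
  fixes \<Sigma> :: "real^'d^'d" and u t :: "real^'d"
  assumes \<Sigma>: "pos_def_sym \<Sigma>"
  shows "u \<bullet> (\<Sigma> *v gradient (\<lambda>t. tnorm_const t \<Sigma>) t)
    = (\<integral>w. (u \<bullet> (w - t)) * gauss_kernel t \<Sigma> w \<partial>orthant_measure)"
proof -
  let ?P = "matrix_inv \<Sigma>" and ?k = "gauss_kernel t \<Sigma>" and ?a = "\<Sigma> *v u"
  have sym: "transpose \<Sigma> = \<Sigma>" using \<Sigma> by (simp add: pos_def_sym_def)
  have int: "integrable orthant_measure (\<lambda>w. (?P *v (w - t)) $ i * ?k w)" for i
  proof -
    have eq: "(?P *v z) $ i = (?P *v axis i 1) \<bullet> z" for z
      using pos_def_sym_inv_commute[OF \<Sigma>, of "axis i 1" z]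
      by (simp add: inner_axis' inner_commute)
    show ?thesis unfolding eq by (rule integrable_directional_moments(2)[OF \<Sigma>])
  qed
  have grad: "gradient (\<lambda>t. tnorm_const t \<Sigma>) t $ i
      = (\<integral>w. (?P *v (w - t)) $ i * ?k w \<partial>orthant_measure)" for i
    by (simp add: gradient_def partial_deriv_tnorm_const[OF \<Sigma>] inner_axis')
  have "u \<bullet> (\<Sigma> *v gradient (\<lambda>t. tnorm_const t \<Sigma>) t)
      = ?a \<bullet> gradient (\<lambda>t. tnorm_const t \<Sigma>) t"
    by (rule symmetric_inner_commute[OF sym])
  also have "\<dots> = (\<Sum>i\<in>UNIV. ?a $ i * (\<integral>w. (?P *v (w - t)) $ i * ?k w \<partial>orthant_measure))"
    by (simp add: inner_vec_def grad)
  also have "\<dots> = (\<integral>w. (\<Sum>i\<in>UNIV. ?a $ i * ((?P *v (w - t)) $ i * ?k w)) \<partial>orthant_measure)"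
    using int by (simp add: Bochner_Integration.integral_sum)
  also have "\<dots> = (\<integral>w. (?a \<bullet> (?P *v (w - t))) * ?k w \<partial>orthant_measure)"
    by (simp add: inner_vec_def sum_distrib_right mult.assoc)
  also have "\<dots> = (\<integral>w. (u \<bullet> (w - t)) * ?k w \<partial>orthant_measure)"
    by (simp add: symmetric_inner_commute[OF sym, symmetric]
        matrix_inv_mult_vec[OF pos_def_sym_invertible[OF \<Sigma>]])
  finally show ?thesis .
qed

text \<open>
  This is \<open>\<Sigma> (\<nabla>\<nabla>' C) \<Sigma> = C (E (W - t)(W - t)' - \<Sigma>)\<close>, tested against \<open>u\<close>. The quadratic form suffices, since
  only positive definiteness of the covariance matrix is at stake.
\<close>

lemma second_moment_eq_hessian:
  fixes \<Sigma> :: "real^'d^'d" and u t :: "real^'d"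
  assumes \<Sigma>: "pos_def_sym \<Sigma>"
  shows "u \<bullet> ((\<Sigma> ** hessian (\<lambda>t. tnorm_const t \<Sigma>) t ** \<Sigma>) *v u)
    = (\<integral>w. (u \<bullet> (w - t))\<^sup>2 * gauss_kernel t \<Sigma> w \<partial>orthant_measure)
      - tnorm_const t \<Sigma> * (u \<bullet> (\<Sigma> *v u))"
proof -
  let ?P = "matrix_inv \<Sigma>" and ?k = "gauss_kernel t \<Sigma>" and ?a = "\<Sigma> *v u"
  let ?H = "hessian (\<lambda>t. tnorm_const t \<Sigma>) t"
  let ?y = "\<lambda>w. ?P *v (w - t)"
  have sym: "transpose \<Sigma> = \<Sigma>" using \<Sigma> by (simp add: pos_def_sym_def)
  note inv = matrix_inv_mult_vec[OF pos_def_sym_invertible[OF \<Sigma>]]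
  note I = integrable_directional_moments[OF \<Sigma>, where t = t]
  have int: "integrable orthant_measure (\<lambda>w. (?y w $ i * ?y w $ j - ?P $ i $ j) * ?k w)" for i j
  proof -
    let ?b = "?P *v axis i 1" and ?c = "?P *v axis j 1"
    have comp: "(?P *v z) $ i = (?P *v axis i 1) \<bullet> z" for z i
      using pos_def_sym_inv_commute[OF \<Sigma>, of "axis i 1" z]
      by (simp add: inner_axis' inner_commute)
    \<comment> \<open>Polarisation reduces integrability of a product of two linear factors to that of squares.\<close>
    have polar: "(?y w $ i * ?y w $ j - ?P $ i $ j) * ?k w
        = ((?b + ?c) \<bullet> (w - t))\<^sup>2 * ?k w / 4 - ((?b - ?c) \<bullet> (w - t))\<^sup>2 * ?k w / 4
          - ?P $ i $ j * ?k w" for w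
      unfolding comp by (simp add: inner_add_left inner_diff_left power2_eq_square field_simps)
    show ?thesis unfolding polar
      by (intro Bochner_Integration.integrable_diff integrable_divide integrable_mult_right I)
  qed
  have quad: "x \<bullet> (A *v x) = (\<Sum>i\<in>UNIV. \<Sum>j\<in>UNIV. x $ i * (x $ j * A $ i $ j))"
    for x and A :: "real^'d^'d"
    by (simp add: inner_vec_def matrix_vector_mult_def sum_distrib_left mult_ac)
  have expand: "(\<Sum>i\<in>UNIV. \<Sum>j\<in>UNIV. a $ i * (a $ j * ((y $ i * y $ j - B $ i $ j) * k)))
      = (a \<bullet> y)\<^sup>2 * k - (a \<bullet> (B *v a)) * k" for a y :: "real^'d" and B :: "real^'d^'d" and k
  proof -
    have "(a \<bullet> y)\<^sup>2 = (\<Sum>i\<in>UNIV. \<Sum>j\<in>UNIV. a $ i * (a $ j * (y $ i * y $ j)))"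
      by (simp add: inner_vec_def power2_eq_square sum_product mult_ac)
    moreover have "a $ i * (a $ j * ((y $ i * y $ j - B $ i $ j) * k))
        = a $ i * (a $ j * (y $ i * y $ j)) * k - a $ i * (a $ j * B $ i $ j) * k" for i j
      by (simp add: left_diff_distrib right_diff_distrib mult.assoc)
    ultimately show ?thesis
      by (simp only: quad sum_distrib_right sum_subtractf)
  qed
  have "u \<bullet> ((\<Sigma> ** ?H ** \<Sigma>) *v u) = ?a \<bullet> (?H *v ?a)"
    by (simp add: matrix_vector_mul_assoc[symmetric] symmetric_inner_commute[OF sym])
  also have "\<dots> = (\<Sum>i\<in>UNIV. \<Sum>j\<in>UNIV. ?a $ i * (?a $ j *
      (\<integral>w. (?y w $ i * ?y w $ j - ?P $ i $ j) * ?k w \<partial>orthant_measure)))"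
    by (simp add: quad hessian_tnorm_const[OF \<Sigma>])
  also have "\<dots> = (\<integral>w. (\<Sum>i\<in>UNIV. \<Sum>j\<in>UNIV.
      ?a $ i * (?a $ j * ((?y w $ i * ?y w $ j - ?P $ i $ j) * ?k w))) \<partial>orthant_measure)"
    using int by (simp add: Bochner_Integration.integral_sum)
  also have "\<dots> = (\<integral>w. (?a \<bullet> ?y w)\<^sup>2 * ?k w - (?a \<bullet> (?P *v ?a)) * ?k w \<partial>orthant_measure)"
    by (simp only: expand)
  also have "\<dots> = (\<integral>w. (u \<bullet> (w - t))\<^sup>2 * ?k w - (u \<bullet> (\<Sigma> *v u)) * ?k w \<partial>orthant_measure)"
    by (simp add: symmetric_inner_commute[OF sym, symmetric] inv)
  also have "\<dots> = (\<integral>w. (u \<bullet> (w - t))\<^sup>2 * ?k w \<partial>orthant_measure) - tnorm_const t \<Sigma> * (u \<bullet> (\<Sigma> *v u))"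
    using I by (simp add: tnorm_const_eq_integral)
  finally show ?thesis .
qed

text \<open>
  A nonnegative function with vanishing integral is zero almost everywhere on the orthant; here this would
  make the open unit cube, a part of the orthant, negligible.
\<close>

lemma orthant_integral_pos:
  fixes f :: "real^'d \<Rightarrow> real"
  assumes f: "integrable orthant_measure f"
    and nonneg: "\<And>w. 0 \<le> f w"
    and pos: "\<And>w. w \<notin> N \<Longrightarrow> 0 < f w"
    and N: "negligible N"
  shows "0 < (\<integral>w. f w \<partial>orthant_measure)"
proof (rule ccontr)
  assume "\<not> ?thesis"
  then have "(\<integral>w. f w \<partial>orthant_measure) = 0"
    using Bochner_Integration.integral_nonneg[of orthant_measure f, OF nonneg] by linarith
  then have "AE w in orthant_measure. f w = 0"
    using integral_nonneg_eq_0_iff_AE[OF f] nonneg by simp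
  then have "AE w in lborel. w \<in> nonneg_orthant \<longrightarrow> f w = 0"
    using borel_closed[OF closed_nonneg_orthant]
      AE_restrict_space_iff[of nonneg_orthant lborel "\<lambda>w. f w = 0"] by simp
  then obtain Z where Z: "\<And>w. w \<in> space lborel - Z \<Longrightarrow> w \<in> nonneg_orthant \<longrightarrow> f w = 0"
      "Z \<in> null_sets lborel"
    using AE_E3 by blast
  have "negligible Z"
    using Z(2) null_sets_completionI[of Z lborel] by (simp add: negligible_iff_null_sets)
  then have "negligible (Z \<union> N)" using N by (rule negligible_Un)
  moreover have "box 0 (\<chi> i. 1) \<subseteq> Z \<union> N"
  proof
    fix w :: "real^'d" assume "w \<in> box 0 (\<chi> i. 1)"
    then have "w \<in> nonneg_orthant"
      by (auto simp: nonneg_orthant_def mem_box_cart intro: less_imp_le)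
    then show "w \<in> Z \<union> N" using Z(1)[of w] pos[of w] by force
  qed
  ultimately have "negligible (box (0::real^'d) (\<chi> i. 1))" by (rule negligible_subset)
  then have "box (0::real^'d) (\<chi> i. 1) = {}"
    using open_not_negligible open_box by blast
  moreover have "(\<chi> i. 1/2) \<in> box (0::real^'d) (\<chi> i. 1)" by (simp add: mem_box_cart)
  ultimately show False by simp
qed

text \<open>
  The difference of the two sides is the variance of \<open>u \<bullet> (W - t)\<close> under the truncated law, the mean of a
  square that vanishes only on a hyperplane.
\<close>

lemma variance_strictly_positive:
  fixes \<Sigma> :: "real^'d^'d" and u t :: "real^'d"
  assumes \<Sigma>: "pos_def_sym \<Sigma>" and u: "u \<noteq> 0"
  defines "C \<equiv> tnorm_const t \<Sigma>"
  shows "(inverse C * (\<integral>w. (u \<bullet> (w - t)) * gauss_kernel t \<Sigma> w \<partial>orthant_measure))\<^sup>2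
    < inverse C * (\<integral>w. (u \<bullet> (w - t))\<^sup>2 * gauss_kernel t \<Sigma> w \<partial>orthant_measure)"
proof -
  let ?k = "gauss_kernel t \<Sigma>"
  note I = integrable_directional_moments[OF \<Sigma>, where t = t]
  define m1 where "m1 = (\<integral>w. (u \<bullet> (w - t)) * ?k w \<partial>orthant_measure)"
  define m2 where "m2 = (\<integral>w. (u \<bullet> (w - t))\<^sup>2 * ?k w \<partial>orthant_measure)"
  have C: "0 < C"
    unfolding C_def tnorm_const_eq_integral
    by (rule orthant_integral_pos[OF I(1), of "{}"]) (auto simp: gauss_kernel_def)
  define m where "m = inverse C * m1"
  have expand: "(u \<bullet> (w - t) - m)\<^sup>2 * ?k w
      = (u \<bullet> (w - t))\<^sup>2 * ?k w - 2 * m * ((u \<bullet> (w - t)) * ?k w) + m\<^sup>2 * ?k w" for w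
    by (simp add: power2_eq_square algebra_simps)
  have int: "integrable orthant_measure (\<lambda>w. (u \<bullet> (w - t) - m)\<^sup>2 * ?k w)"
    unfolding expand
    by (intro Bochner_Integration.integrable_add Bochner_Integration.integrable_diff
        integrable_mult_right I)
  have "0 < (\<integral>w. (u \<bullet> (w - t) - m)\<^sup>2 * ?k w \<partial>orthant_measure)"
  proof (rule orthant_integral_pos[OF int])
    show "negligible {w. u \<bullet> w = u \<bullet> t + m}" using u by (intro negligible_hyperplane) auto
    show "0 < (u \<bullet> (w - t) - m)\<^sup>2 * ?k w" if "w \<notin> {w. u \<bullet> w = u \<bullet> t + m}" for w
      using that by (auto simp: gauss_kernel_def inner_diff_right)
  qed (simp add: gauss_kernel_def)
  also have "\<dots> = m2 - 2 * m * m1 + m\<^sup>2 * C"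
    unfolding expand m1_def m2_def C_def tnorm_const_eq_integral
    using I by simp
  also have "\<dots> = C * (inverse C * m2 - m\<^sup>2)"
    using C by (simp add: m_def power2_eq_square field_simps)
  finally show ?thesis
    using C by (simp add: zero_less_mult_iff m_def m1_def m2_def)
qed

section \<open>The sample scatter matrix\<close>

lemma outer_prod_quadratic_form:
  fixes a u :: "real^'d"
  shows "u \<bullet> (outer_prod a a *v u) = (a \<bullet> u)\<^sup>2"
  by (simp add: outer_prod_def inner_vec_def matrix_vector_mult_def power2_eq_square
      sum_product sum_distrib_left mult_ac)

lemma sample_scatter_quadratic_form:
  fixes x :: "nat \<Rightarrow> real^'d"
  shows "u \<bullet> (sample_scatter n x \<alpha> *v u) = (1 / real n) * (\<Sum>j=1..n. ((x j - \<alpha>) \<bullet> u)\<^sup>2)"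
proof -
  have "(\<Sum>j\<in>A. B j) *v u = (\<Sum>j\<in>A. B j *v u)" for A and B :: "nat \<Rightarrow> real^'d^'d"
    by (induction A rule: infinite_finite_induct) (auto simp: matrix_vector_mult_add_rdistrib)
  then show ?thesis
    by (simp add: sample_scatter_def scaleR_matrix_vector_assoc[symmetric] inner_sum_right
        outer_prod_quadratic_form)
qed

text \<open>
  The decomposition \<open>S(\<alpha>) = S(xbar) + (xbar - \<alpha>)(xbar - \<alpha>)'\<close> as quadratic forms; the cross terms cancel
  because the deviations from the mean sum to zero.
\<close>

lemma sample_scatter_shift:
  fixes x :: "nat \<Rightarrow> real^'d"
  assumes "n > 0"
  shows "u \<bullet> (sample_scatter n x \<alpha> *v u)
    = u \<bullet> (sample_scatter n x (sample_mean n x) *v u) + ((sample_mean n x - \<alpha>) \<bullet> u)\<^sup>2"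
proof -
  let ?m = "sample_mean n x"
  define d where "d = (?m - \<alpha>) \<bullet> u"
  have "(\<Sum>j=1..n. x j) = real n *\<^sub>R ?m" using assms by (simp add: sample_mean_def)
  then have centred: "(\<Sum>j=1..n. (x j - ?m) \<bullet> u) = 0"
    by (simp add: inner_sum_left[symmetric] sum_subtractf sum_constant_scaleR del: sum_constant)
  have "((x j - \<alpha>) \<bullet> u)\<^sup>2 = ((x j - ?m) \<bullet> u)\<^sup>2 + 2 * d * ((x j - ?m) \<bullet> u) + d\<^sup>2" for j
    by (simp add: d_def inner_diff_left power2_eq_square algebra_simps)
  then have "(\<Sum>j=1..n. ((x j - \<alpha>) \<bullet> u)\<^sup>2)
      = (\<Sum>j=1..n. ((x j - ?m) \<bullet> u)\<^sup>2) + 2 * d * (\<Sum>j=1..n. (x j - ?m) \<bullet> u) + real n * d\<^sup>2"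
    by (simp add: sum.distrib sum_distrib_left)
  then show ?thesis
    using assms by (simp add: sample_scatter_quadratic_form centred d_def distrib_left del: One_nat_def)
qed

text \<open>
  By the two moment identities the quadratic form of \<open>S(xbar)\<close> at \<open>u\<close> is the variance of \<open>u \<bullet> W\<close> under the
  law with parameters \<open>\<mu>, \<Sigma>\<close>.
\<close>

lemma score_equations_scatter_pos_def:
  fixes x :: "nat \<Rightarrow> real^'d"
  assumes \<Sigma>: "pos_def_sym \<Sigma>" and score: "score_equations n x \<mu> \<Sigma>" and u: "u \<noteq> 0"
  shows "0 < u \<bullet> (sample_scatter n x (sample_mean n x) *v u)"
proof -
  let ?C = "tnorm_const \<mu> \<Sigma>" and ?v = "sample_mean n x - \<mu>"
  let ?H = "hessian (\<lambda>t. tnorm_const t \<Sigma>) \<mu>"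
  let ?m1 = "\<integral>w. (u \<bullet> (w - \<mu>)) * gauss_kernel \<mu> \<Sigma> w \<partial>orthant_measure"
  let ?m2 = "\<integral>w. (u \<bullet> (w - \<mu>))\<^sup>2 * gauss_kernel \<mu> \<Sigma> w \<partial>orthant_measure"
  \<comment> \<open>If the normalising constant were \<open>0\<close>, its inverse would be \<open>0\<close> as well, and the strict inequality
      for the variance would read \<open>0 < 0\<close>.\<close>
  have C: "?C \<noteq> 0" using variance_strictly_positive[OF \<Sigma> u, of \<mu>] by auto
  have "?v = inverse ?C *\<^sub>R (\<Sigma> *v gradient (\<lambda>t. tnorm_const t \<Sigma>) \<mu>)"
    using score by (auto simp: score_equations_def algebra_simps)
  then have mean: "?v \<bullet> u = inverse ?C * ?m1"
    by (simp add: inner_commute[of _ u] first_moment_eq_gradient[OF \<Sigma>])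
  have "sample_scatter n x (sample_mean n x)
      = \<Sigma> + inverse ?C *\<^sub>R (\<Sigma> ** ?H ** \<Sigma>) - outer_prod ?v ?v"
    using score by (simp add: score_equations_def)
  then have "u \<bullet> (sample_scatter n x (sample_mean n x) *v u)
      = u \<bullet> (\<Sigma> *v u) + inverse ?C * (u \<bullet> ((\<Sigma> ** ?H ** \<Sigma>) *v u)) - (?v \<bullet> u)\<^sup>2"
    by (simp only: matrix_vector_mult_add_rdistrib matrix_vector_mult_diff_rdistrib
        scaleR_matrix_vector_assoc[symmetric] inner_add_right inner_diff_right
        inner_scaleR_right outer_prod_quadratic_form)
  also have "\<dots> = inverse ?C * ?m2 - (inverse ?C * ?m1)\<^sup>2"
    using C by (simp add: second_moment_eq_hessian[OF \<Sigma>] mean right_diff_distrib)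
  also have "\<dots> > 0" using variance_strictly_positive[OF \<Sigma> u, of \<mu>] by simp
  finally show ?thesis .
qed

theorem proposition4p6:
  fixes M :: "'a measure"
    and X :: "nat \<Rightarrow> 'a \<Rightarrow> real^'d"
    and \<mu> \<mu>hat :: "real^'d"
    and \<Sigma> \<Sigma>hat :: "real^'d^'d"
    and n :: nat
    and \<omega> :: 'a
  defines "x \<equiv> \<lambda>j. X j \<omega>"
  defines "xbar \<equiv> sample_mean n x"
  defines "Shat \<equiv> sample_scatter n x \<mu>hat"
  assumes "pos_def_sym \<Sigma>"
    and "tnorm_random_sample M n X \<mu> \<Sigma>"
    and "n > CARD('d)"
    and "\<omega> \<in> space M"
    and "pos_def_sym \<Sigma>hat"
    and "score_equations n x \<mu>hat \<Sigma>hat"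
  shows "invertible Shat
    \<and> 0 \<le> (xbar - \<mu>hat) \<bullet> (matrix_inv Shat *v (xbar - \<mu>hat))
    \<and> (xbar - \<mu>hat) \<bullet> (matrix_inv Shat *v (xbar - \<mu>hat)) < 1"
proof -
  have "n > 0" using \<open>n > CARD('d)\<close> by simp
  then have "((xbar - \<mu>hat) \<bullet> u)\<^sup>2 < u \<bullet> (Shat *v u)" if "u \<noteq> 0" for u
    using score_equations_scatter_pos_def[OF \<open>pos_def_sym \<Sigma>hat\<close>
        \<open>score_equations n x \<mu>hat \<Sigma>hat\<close> that]
    by (simp add: Shat_def xbar_def sample_scatter_shift[of n u x \<mu>hat])
  then show ?thesis using quadratic_form_rank_one_update by blast
qed

end
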